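(* Let $m\in\mathbb{N}$, let $q$ be a prime power with $(m,q)\neq(1,2)$, and let $G:=\mathrm{Hol}(q,m)$. Then $\textsc{coPolEqv}(G)$ is polytime-reducible to $\textsc{PolSat}(G)$.
   Context: $\mathrm{Hol}(q,m)$ is the group of pairs $(a,B)$ with $a\in\mathbb{F}_q^m$, $B\in\mathrm{GL}_m(\mathbb{F}_q)$, and multiplication $(v,A)\cdot(w,B)=(v+Aw,AB)$. For a group $G$ and set of variables $X$, inputs are words $w\in(G\cup X)^*$, evaluated as products in $G$ under assignments $X\to G$. $\textsc{coPolEqv}(G)$: decide whether some assignment makes $w$ evaluate to an element different from $1$. $\textsc{PolSat}(G)$: decide whether some assignment makes $w$ evaluate to $1$. Polytime-reducible: there is a polynomial-time transformation $P$ of inputs with $A(e)\iff B(P(e))$. *)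

theory Defs
  imports
    "Jordan_Normal_Form.Matrix"
    "HOL-Algebra.Group"
    "HOL-Computational_Algebra.Polynomial"
    "HOL-Number_Theory.Prime_Powers"
    "HOL-Library.Cardinality"
begin

text \<open>The field with \<open>q\<close> elements is given by a finite field type \<open>'f\<close> with \<open>CARD('f) = q\<close>;
  hence only the dimension \<open>m\<close> is an explicit argument.\<close>

definition GL :: "nat \<Rightarrow> 'f::field mat set" where
  "GL m = {B \<in> carrier_mat m m. invertible_mat B}"

definition Hol :: "nat \<Rightarrow> ('f::field vec \<times> 'f mat) monoid" where
  "Hol m = \<lparr>carrier = carrier_vec m \<times> GL m,
            mult = (\<lambda>(v, A) (w, B). (v + A *\<^sub>v w, A * B)),
            one = (0\<^sub>v m, 1\<^sub>m m)\<rparr>"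

text \<open>The variables form a countably infinite set, indexed by \<^typ>\<open>nat\<close>.\<close>

datatype 'g letter = Const 'g | Var nat

definition pol_words :: "('g, 'b) monoid_scheme \<Rightarrow> 'g letter list set" where
  "pol_words G = {w. \<forall>g. Const g \<in> set w \<longrightarrow> g \<in> carrier G}"

fun letter_val :: "(nat \<Rightarrow> 'g) \<Rightarrow> 'g letter \<Rightarrow> 'g" where
  "letter_val \<sigma> (Const g) = g"
| "letter_val \<sigma> (Var x) = \<sigma> x"

fun word_val :: "('g, 'b) monoid_scheme \<Rightarrow> (nat \<Rightarrow> 'g) \<Rightarrow> 'g letter list \<Rightarrow> 'g" where
  "word_val G \<sigma> [] = \<one>\<^bsub>G\<^esub>"
| "word_val G \<sigma> (l # w) = letter_val \<sigma> l \<otimes>\<^bsub>G\<^esub> word_val G \<sigma> w"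

definition coPolEqv :: "('g, 'b) monoid_scheme \<Rightarrow> 'g letter list \<Rightarrow> bool" where
  "coPolEqv G w \<longleftrightarrow> (\<exists>\<sigma>. (\<forall>x. \<sigma> x \<in> carrier G) \<and> word_val G \<sigma> w \<noteq> \<one>\<^bsub>G\<^esub>)"

definition PolSat :: "('g, 'b) monoid_scheme \<Rightarrow> 'g letter list \<Rightarrow> bool" where
  "PolSat G w \<longleftrightarrow> (\<exists>\<sigma>. (\<forall>x. \<sigma> x \<in> carrier G) \<and> word_val G \<sigma> w = \<one>\<^bsub>G\<^esub>)"

text \<open>Inputs as strings over a finite alphabet: since \<open>G\<close> is a fixed finite group, each of its
  elements is one symbol; the variable with index \<open>n\<close> is a marker followed by \<open>n\<close> in binary,
  least significant bit first.\<close>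

datatype 'g symbol = Elem 'g | VarMark | Bit bool

fun nat_bits :: "nat \<Rightarrow> bool list" where
  "nat_bits n = (if n = 0 then [] else odd n # nat_bits (n div 2))"

declare nat_bits.simps [simp del]

fun encode_letter :: "'g letter \<Rightarrow> 'g symbol list" where
  "encode_letter (Const g) = [Elem g]"
| "encode_letter (Var n) = VarMark # map Bit (nat_bits n)"

definition encode_word :: "'g letter list \<Rightarrow> 'g symbol list" where
  "encode_word w = concat (map encode_letter w)"

text \<open>Deterministic multi-tape Turing machines with two-way infinite tapes. A missing transition
  means halting. The input is on the first tape and the output on the last one (for a one-tape
  machine these coincide).\<close>

datatype 'a tape_symbol = Blank | Sym 'a | Aux nat

datatype move = MoveLeft | Stay | MoveRight

record 'a tm =
  tape_count :: nat
  states :: "nat set"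
  start :: nat
  alphabet :: "'a tape_symbol set"
  delta :: "nat \<Rightarrow> 'a tape_symbol list \<Rightarrow> (nat \<times> ('a tape_symbol \<times> move) list) option"

definition wf_tm :: "'a tm \<Rightarrow> bool" where
  "wf_tm M \<longleftrightarrow>
     tape_count M \<ge> 1 \<and> finite (states M) \<and> start M \<in> states M \<and>
     finite (alphabet M) \<and> Blank \<in> alphabet M \<and>
     (\<forall>q ss q' as. q \<in> states M \<and> length ss = tape_count M \<and> set ss \<subseteq> alphabet M \<and>
        delta M q ss = Some (q', as) \<longrightarrow>
        q' \<in> states M \<and> length as = tape_count M \<and> fst ` set as \<subseteq> alphabet M)"

text \<open>A tape is its content together with its head position.\<close>

type_synonym 'a tape = "(int \<Rightarrow> 'a tape_symbol) \<times> int"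
type_synonym 'a config = "nat \<times> 'a tape list"

definition tape_content :: "'a list \<Rightarrow> int \<Rightarrow> 'a tape_symbol" where
  "tape_content u i = (if 0 \<le> i \<and> i < int (length u) then Sym (u ! nat i) else Blank)"

definition read_tape :: "'a tape \<Rightarrow> 'a tape_symbol" where
  "read_tape = (\<lambda>(c, h). c h)"

fun move_head :: "move \<Rightarrow> int \<Rightarrow> int" where
  "move_head MoveLeft h = h - 1"
| "move_head Stay h = h"
| "move_head MoveRight h = h + 1"

definition act_tape :: "'a tape_symbol \<times> move \<Rightarrow> 'a tape \<Rightarrow> 'a tape" where
  "act_tape = (\<lambda>(s, d) (c, h). (c(h := s), move_head d h))"

definition init_config :: "'a tm \<Rightarrow> 'a list \<Rightarrow> 'a config" where
  "init_config M u =
     (start M, (tape_content u, 0) # replicate (tape_count M - 1) (tape_content [], 0))"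

definition halted :: "'a tm \<Rightarrow> 'a config \<Rightarrow> bool" where
  "halted M = (\<lambda>(q, ts). delta M q (map read_tape ts) = None)"

definition step :: "'a tm \<Rightarrow> 'a config \<Rightarrow> 'a config" where
  "step M = (\<lambda>(q, ts). case delta M q (map read_tape ts) of
       None \<Rightarrow> (q, ts)
     | Some (q', as) \<Rightarrow> (q', map2 act_tape as ts))"

definition computes_in :: "'a tm \<Rightarrow> 'a list \<Rightarrow> 'a list \<Rightarrow> nat \<Rightarrow> bool" where
  "computes_in M u v t \<longleftrightarrow>
     (let c = (step M ^^ t) (init_config M u)
      in halted M c \<and> fst (last (snd c)) = tape_content v)"

definition polytime_computable :: "('e \<Rightarrow> 'a list) \<Rightarrow> 'e set \<Rightarrow> ('e \<Rightarrow> 'e) \<Rightarrow> bool" where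
  "polytime_computable enc I P \<longleftrightarrow>
     (\<exists>(M :: 'a tm) (p :: nat poly). wf_tm M \<and>
        (\<forall>e\<in>I. Sym ` set (enc e) \<subseteq> alphabet M \<and>
           (\<exists>t \<le> poly p (length (enc e)). computes_in M (enc e) (enc (P e)) t)))"

definition polytime_reducible ::
    "('e \<Rightarrow> 'a list) \<Rightarrow> 'e set \<Rightarrow> ('e \<Rightarrow> bool) \<Rightarrow> ('e \<Rightarrow> bool) \<Rightarrow> bool" where
  "polytime_reducible enc I A B \<longleftrightarrow>
     (\<exists>P. P ` I \<subseteq> I \<and> polytime_computable enc I P \<and> (\<forall>e\<in>I. A e \<longleftrightarrow> B (P e)))"

end

theory Submission
  imports
    Defs
    "Jordan_Normal_Form.Schur_Decomposition"
    "Jordan_Normal_Form.DL_Rank"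
    "HOL-Algebra.Multiplicative_Group"
begin

text \<open>In the holomorph every \<open>g \<noteq> 1\<close> has a commutator \<open>[g, y]\<close> that is a nontrivial translation:
  take a translation for \<open>y\<close> if the linear part of \<open>g\<close> is nontrivial; otherwise \<open>g\<close> is a translation
  itself and \<open>y\<close> is a linear map moving its vector, which exists unless \<open>(m, q) = (1, 2)\<close>. Since the
  general linear group is transitive on nonzero vectors, a conjugate \<open>z [g, y] z\<^sup>-\<^sup>1\<close> equals a fixed
  nontrivial translation \<open>v\<close>. Hence \<open>w\<close> takes a value other than \<open>1\<close> iff \<open>z [w, y] z\<^sup>-\<^sup>1 v\<^sup>-\<^sup>1 = 1\<close> is
  solvable with fresh variables \<open>y\<close> and \<open>z\<close>.\<close>

section \<open>Two-tape machines that emit symbols and copy the input\<close>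

text \<open>The reduction writes constant pieces and several renamed copies of its input, so
  straight-line programs over these two instructions suffice.\<close>

datatype 'a instr = Emit 'a | Copy

text \<open>As bits are written least significant first, this renames every variable \<open>n\<close> to \<open>2 * n + 1\<close>.\<close>

definition mark :: "'g symbol list \<Rightarrow> 'g symbol list" where
  "mark u = concat (map (\<lambda>a. if a = VarMark then [VarMark, Bit True] else [a]) u)"

fun instr_output :: "'g symbol list \<Rightarrow> 'g symbol instr \<Rightarrow> 'g symbol list" where
  "instr_output u (Emit a) = [a]"
| "instr_output u Copy = mark u"

definition program_output :: "'g symbol instr list \<Rightarrow> 'g symbol list \<Rightarrow> 'g symbol list" where
  "program_output prog u = concat (map (instr_output u) prog)"

text \<open>While instruction \<open>i\<close> is executed, the state is \<open>3 * i + s\<close>: for \<open>s = 0\<close> the machine emits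
  or copies, for \<open>s = 1\<close> it inserts the bit after a variable marker, and for \<open>s = 2\<close> it rewinds
  the input tape.\<close>

definition program_delta ::
  "'g symbol instr list \<Rightarrow> nat \<Rightarrow> 'g symbol tape_symbol list \<Rightarrow>
    (nat \<times> ('g symbol tape_symbol \<times> move) list) option" where
  "program_delta prog q ss =
    (let i = q div 3; a = ss ! 0; b = ss ! 1 in
     if length prog \<le> i then None
     else case prog ! i of
       Emit s \<Rightarrow> Some (3 * Suc i, [(a, Stay), (Sym s, MoveRight)])
     | Copy \<Rightarrow>
         if q mod 3 = 0 then
           if a = Blank then Some (3 * i + 2, [(a, MoveLeft), (b, Stay)])
           else Some (if a = Sym VarMark then 3 * i + 1 else 3 * i, [(a, MoveRight), (a, MoveRight)])
         else if q mod 3 = 1 then Some (3 * i, [(a, Stay), (Sym (Bit True), MoveRight)])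
         else if a = Blank then Some (3 * Suc i, [(a, MoveRight), (b, Stay)])
         else Some (3 * i + 2, [(a, MoveLeft), (b, Stay)]))"

text \<open>A finished program reaches state \<open>3 * length prog\<close>, where
  \<open>program_delta\<close> is undefined, so the machine halts there.\<close>

definition program_tm :: "'g symbol set \<Rightarrow> 'g symbol instr list \<Rightarrow> 'g symbol tm" where
  "program_tm A prog = \<lparr>tape_count = 2, states = {..3 * length prog + 2}, start = 0,
     alphabet = insert Blank (Sym ` A), delta = program_delta prog\<rparr>"

lemma wf_program_tm:
  assumes "finite A" "Bit True \<in> A" "\<And>s. Emit s \<in> set prog \<Longrightarrow> s \<in> A"
  shows "wf_tm (program_tm A prog)"
proof -
  \<comment> \<open>Nothing is assumed about \<open>q\<close>: a transition exists only if
    \<open>q div 3 < length prog\<close>, and this alone bounds the successor state.\<close>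
  have "q' \<in> states (program_tm A prog) \<and> length as = 2 \<and> fst ` set as \<subseteq> alphabet (program_tm A prog)"
    if "length ss = 2" and ss: "set ss \<subseteq> alphabet (program_tm A prog)"
      and d: "program_delta prog q ss = Some (q', as)" for q ss q' as
  proof -
    obtain a b where ab: "ss = [a, b]"
      using \<open>length ss = 2\<close> by (auto simp: numeral_2_eq_2 length_Suc_conv)
    have i: "q div 3 < length prog"
      using d by (auto simp: program_delta_def Let_def split: if_splits)
    show ?thesis
    proof (cases "prog ! (q div 3)")
      case (Emit s)
      then have "s \<in> A" using i assms(3) by (metis nth_mem)
      then show ?thesis
        using d ss i Emit by (auto simp: ab program_delta_def program_tm_def Let_def)
    next
      case Copy
      then show ?thesis
        using d ss i assms(2)
        by (auto simp: ab program_delta_def program_tm_def Let_def split: if_splits)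
    qed
  qed
  then show ?thesis
    using assms(1) unfolding wf_tm_def by (fastforce simp: program_tm_def)
qed

section \<open>Effect of single instructions on the two tapes\<close>

lemma tape_content_append:
  "(tape_content v)(int (length v) := Sym s) = tape_content (v @ [s])"
  by (auto simp: tape_content_def fun_eq_iff nth_append)

text \<open>Invariant of the output tape: the head rests on the first blank after the word, so
  writing a symbol appends it.\<close>

abbreviation out_tape :: "'a list \<Rightarrow> 'a tape" where
  "out_tape v \<equiv> (tape_content v, int (length v))"

lemma tape_content_end [simp]: "tape_content v (int (length v)) = Blank"
  by (simp add: tape_content_def)

lemma tape_content_nth [simp]: "tape_content (x @ a # y) (int (length x)) = Sym a"
  by (simp add: tape_content_def)

lemma funpow_add_apply:
  "(f ^^ s) c = c' \<Longrightarrow> (f ^^ t) c' = c'' \<Longrightarrow> (f ^^ (s + t)) c = c''"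
  by (simp add: add.commute[of s t] funpow_add)

lemma state_div_mod:
  "Suc (3 * i) div 3 = i" "Suc (3 * i) mod 3 = 1"
  "Suc (Suc (3 * i)) div 3 = i" "Suc (Suc (3 * i)) mod 3 = 2"
  by presburger+

lemma step_emit:
  assumes "i < length prog" "prog ! i = Emit s"
  shows "step (program_tm A prog) (3 * i, [(c, h), out_tape v]) =
    (3 * Suc i, [(c, h), out_tape (v @ [s])])"
  using assms
  by (simp add: step_def program_tm_def program_delta_def read_tape_def act_tape_def
      tape_content_append)

context
  fixes A :: "'g symbol set" and prog :: "'g symbol instr list" and i :: nat
  assumes i: "i < length prog" "prog ! i = Copy"
begin

lemma step_copy_blank:
  assumes "c h = Blank"
  shows "step (program_tm A prog) (3 * i, [(c, h), out_tape v]) =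
    (3 * i + 2, [(c, h - 1), out_tape v])"
  using assms i
  by (simp add: step_def program_tm_def program_delta_def read_tape_def act_tape_def fun_upd_idem)

lemma step_copy_symbol:
  assumes "c h = Sym a"
  shows "step (program_tm A prog) (3 * i, [(c, h), out_tape v]) =
    (if a = VarMark then 3 * i + 1 else 3 * i, [(c, h + 1), out_tape (v @ [a])])"
  using assms i
  by (simp add: step_def program_tm_def program_delta_def read_tape_def act_tape_def fun_upd_idem
      tape_content_append Let_def)

text \<open>The input head has already advanced past the marker, so it stays put while the extra bit
  is written.\<close>

lemma step_insert_bit:
  "step (program_tm A prog) (3 * i + 1, [(c, h), out_tape v]) =
    (3 * i, [(c, h), out_tape (v @ [Bit True])])"
  using i state_div_mod[of i]
  by (simp add: step_def program_tm_def program_delta_def read_tape_def act_tape_def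
      tape_content_append Let_def)

lemma step_rewind:
  "step (program_tm A prog) (3 * i + 2, [(c, h), out_tape v]) =
    (if c h = Blank then (3 * Suc i, [(c, h + 1), out_tape v])
     else (3 * i + 2, [(c, h - 1), out_tape v]))"
  using i state_div_mod[of i]
  by (simp add: step_def program_tm_def program_delta_def read_tape_def act_tape_def fun_upd_idem
      Let_def)

text \<open>\<open>x\<close> is the part already read; it grows during the induction while the tape
  content stays the same. A marker costs a second step for its bit, hence the factor 2.\<close>

lemma steps_copy:
  "\<exists>t \<le> 2 * length y. (step (program_tm A prog) ^^ t)
      (3 * i, [(tape_content (x @ y), int (length x)), out_tape v]) =
      (3 * i, [(tape_content (x @ y), int (length (x @ y))), out_tape (v @ mark y)])"
proof (induction y arbitrary: x v)
  case Nil
  then show ?case by (simp add: mark_def)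
next
  case (Cons a y)
  let ?f = "step (program_tm A prog)"
  define v' where "v' = (if a = VarMark then v @ [VarMark, Bit True] else v @ [a])"
  have "\<exists>s \<le> 2. (?f ^^ s) (3 * i, [(tape_content (x @ a # y), int (length x)), out_tape v]) =
    (3 * i, [(tape_content (x @ a # y), int (length x) + 1), out_tape v'])"
  proof (cases "a = VarMark")
    case True
    then show ?thesis
      using step_copy_symbol[of "tape_content (x @ a # y)" "int (length x)" a v]
        step_insert_bit[of "tape_content (x @ a # y)" "int (length x) + 1" "v @ [a]"]
      by (intro exI[of _ 2]) (simp add: numeral_2_eq_2 v'_def)
  next
    case False
    then show ?thesis
      using step_copy_symbol[of "tape_content (x @ a # y)" "int (length x)" a v]
      by (intro exI[of _ 1]) (simp add: v'_def)
  qed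
  then obtain s where s: "s \<le> 2"
    "(?f ^^ s) (3 * i, [(tape_content (x @ a # y), int (length x)), out_tape v]) =
     (3 * i, [(tape_content (x @ a # y), int (length x) + 1), out_tape v'])" by blast
  obtain t where t: "t \<le> 2 * length y"
    "(?f ^^ t) (3 * i, [(tape_content (x @ a # y), int (length x) + 1), out_tape v']) =
     (3 * i, [(tape_content (x @ a # y), int (length (x @ a # y))), out_tape (v' @ mark y)])"
    using Cons.IH[of "x @ [a]" v'] by (auto simp: add.commute)
  have "v' @ mark y = v @ mark (a # y)" by (simp add: v'_def mark_def)
  then show ?case
    using funpow_add_apply[OF s(2) t(2)] s(1) t(1) by (intro exI[of _ "s + t"]) simp
qed

text \<open>From position \<open>h - 1\<close> the head crosses \<open>h\<close> symbols to the
  blank at \<open>-1\<close>; one more step puts it back on \<open>0\<close>.\<close>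

lemma steps_rewind:
  assumes "h \<le> length u"
  shows "(step (program_tm A prog) ^^ Suc h) (3 * i + 2, [(tape_content u, int h - 1), out_tape v]) =
    (3 * Suc i, [(tape_content u, 0), out_tape v])"
  using assms
proof (induction h)
  case 0
  have "tape_content u (- 1) = Blank" by (simp add: tape_content_def)
  then show ?case using step_rewind[of "tape_content u" "-1" v] by simp
next
  case (Suc h)
  then have "tape_content u (int h) \<noteq> Blank" by (simp add: tape_content_def)
  then have "step (program_tm A prog) (3 * i + 2, [(tape_content u, int h), out_tape v]) =
      (3 * i + 2, [(tape_content u, int h - 1), out_tape v])"
    using step_rewind[of "tape_content u" "int h" v] by simp
  then show ?case
    using Suc by (simp add: funpow_Suc_right del: funpow.simps)
qed

lemma steps_copy_instr:
  "\<exists>t \<le> 3 * length u + 2. (step (program_tm A prog) ^^ t)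
      (3 * i, [(tape_content u, 0), out_tape v]) =
      (3 * Suc i, [(tape_content u, 0), out_tape (v @ mark u)])"
proof -
  let ?f = "step (program_tm A prog)"
  obtain t where t: "t \<le> 2 * length u" "(?f ^^ t) (3 * i, [(tape_content u, 0), out_tape v]) =
      (3 * i, [(tape_content u, int (length u)), out_tape (v @ mark u)])"
    using steps_copy[of u "[]" v] by auto
  have "(?f ^^ 1) (3 * i, [(tape_content u, int (length u)), out_tape (v @ mark u)]) =
      (3 * i + 2, [(tape_content u, int (length u) - 1), out_tape (v @ mark u)])"
    using step_copy_blank[of "tape_content u" "int (length u)" "v @ mark u"] by simp
  \<comment> \<open>For an input of length \<open>n\<close>, copying takes at most
    \<open>2 * n\<close> steps, turning round at the blank takes one, and rewinding takes
    \<open>n + 1\<close>.\<close>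
  from funpow_add_apply[OF funpow_add_apply[OF t(2) this] steps_rewind[OF order.refl]]
  show ?thesis using t(1) by (intro exI[of _ "t + 1 + Suc (length u)"]) simp
qed

end

section \<open>Whole programs and their linear running time\<close>

text \<open>Each instruction leaves the input head at position \<open>0\<close>, so the bounds for
  single instructions add up.\<close>

lemma steps_program:
  assumes "i \<le> length prog"
  shows "\<exists>t \<le> i * (3 * length u + 2). (step (program_tm A prog) ^^ t)
      (0, [(tape_content u, 0), out_tape []]) =
      (3 * i, [(tape_content u, 0), out_tape (program_output (take i prog) u)])"
  using assms
proof (induction i)
  case 0
  then show ?case by (simp add: program_output_def)
next
  case (Suc i)
  let ?f = "step (program_tm A prog)" and ?v = "program_output (take i prog) u"
  have i: "i < length prog" using Suc.prems by simp
  obtain s where s: "s \<le> i * (3 * length u + 2)"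
    "(?f ^^ s) (0, [(tape_content u, 0), out_tape []]) = (3 * i, [(tape_content u, 0), out_tape ?v])"
    using Suc by auto
  have "\<exists>t \<le> 3 * length u + 2. (?f ^^ t) (3 * i, [(tape_content u, 0), out_tape ?v]) =
      (3 * Suc i, [(tape_content u, 0), out_tape (?v @ instr_output u (prog ! i))])"
  proof (cases "prog ! i")
    case (Emit a)
    show ?thesis
      using step_emit[OF i Emit, of A "tape_content u" 0 ?v] Emit by (intro exI[of _ 1]) simp
  next
    case Copy
    show ?thesis using steps_copy_instr[OF i Copy] Copy by simp
  qed
  then obtain t where t: "t \<le> 3 * length u + 2"
    "(?f ^^ t) (3 * i, [(tape_content u, 0), out_tape ?v]) =
      (3 * Suc i, [(tape_content u, 0), out_tape (?v @ instr_output u (prog ! i))])" by blast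
  have "?v @ instr_output u (prog ! i) = program_output (take (Suc i) prog) u"
    using i by (simp add: program_output_def take_Suc_conv_app_nth)
  then show ?case
    using funpow_add_apply[OF s(2) t(2)] s(1) t(1) by (intro exI[of _ "s + t"]) simp
qed

lemma polytime_computable_program:
  assumes "finite A" "Bit True \<in> A" "\<And>s. Emit s \<in> set prog \<Longrightarrow> s \<in> A"
    and enc: "\<And>e. e \<in> I \<Longrightarrow> set (enc e) \<subseteq> A"
    and P: "\<And>e. e \<in> I \<Longrightarrow> enc (P e) = program_output prog (enc e)"
  shows "polytime_computable enc I P"
proof -
  \<comment> \<open>The polynomial is \<open>length prog * (3 * n + 2)\<close>, linear in the input
    length \<open>n\<close> because the program is fixed.\<close>
  let ?M = "program_tm A prog" and ?p = "[:2 * length prog, 3 * length prog:]"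
  have "\<exists>t \<le> poly ?p (length (enc e)). computes_in ?M (enc e) (enc (P e)) t" if "e \<in> I" for e
  proof -
    obtain t where t: "t \<le> length prog * (3 * length (enc e) + 2)"
      "(step ?M ^^ t) (0, [(tape_content (enc e), 0), out_tape []]) =
        (3 * length prog, [(tape_content (enc e), 0), out_tape (program_output prog (enc e))])"
      using steps_program[of "length prog" prog "enc e" A] by auto
    have "init_config ?M (enc e) = (0, [(tape_content (enc e), 0), out_tape []])"
      by (simp add: init_config_def program_tm_def)
    moreover have "halted ?M (3 * length prog, ts)" for ts
      by (simp add: halted_def program_tm_def program_delta_def)
    ultimately have "computes_in ?M (enc e) (enc (P e)) t"
      using t(2) P[OF that] by (simp add: computes_in_def)
    moreover have "t \<le> poly ?p (length (enc e))"
      using t(1) by (simp add: algebra_simps)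
    ultimately show ?thesis by blast
  qed
  moreover have "Sym ` set (enc e) \<subseteq> alphabet ?M" if "e \<in> I" for e
    using enc[OF that] by (auto simp: program_tm_def)
  moreover have "wf_tm ?M" using assms(1-3) by (rule wf_program_tm)
  ultimately show ?thesis unfolding polytime_computable_def by blast
qed

section \<open>Reducing through a commutator identity\<close>

text \<open>Renaming onto the odd indices leaves the even ones free for fresh variables, and on
  encodings it only inserts one bit after each marker.\<close>

fun shift_letter :: "'g letter \<Rightarrow> 'g letter" where
  "shift_letter (Const g) = Const g"
| "shift_letter (Var n) = Var (2 * n + 1)"

lemma encode_word_append [simp]: "encode_word (u @ v) = encode_word u @ encode_word v"
  by (simp add: encode_word_def)

lemma mark_append: "mark (u @ v) = mark u @ mark v"
  by (simp add: mark_def)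

lemma mark_map_Bit: "mark (map Bit bs) = map Bit bs"
  by (induction bs) (simp_all add: mark_def)

lemma encode_letter_shift: "encode_letter (shift_letter l) = mark (encode_letter l)"
  for l :: "'a letter"
proof (cases l)
  case (Var n)
  \<comment> \<open>The new lowest bit is set; this covers \<open>n = 0\<close> as well, whose code
    is empty.\<close>
  have "nat_bits (2 * n + 1) = True # nat_bits n"
    by (subst nat_bits.simps) simp
  moreover have "mark (VarMark # map Bit bs) = (VarMark # Bit True # map Bit bs :: 'a symbol list)" for bs
    using mark_append[of "[VarMark]" "map Bit bs"] by (simp add: mark_map_Bit) (simp add: mark_def)
  ultimately show ?thesis by (simp add: Var)
qed (simp add: mark_def)

lemma encode_word_shift: "encode_word (map shift_letter w) = mark (encode_word w)"
  by (induction w) (simp_all add: encode_word_def encode_letter_shift mark_append mark_def[of "[]"])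

lemma set_encode_word:
  assumes "w \<in> pol_words G"
  shows "set (encode_word w) \<subseteq> Elem ` carrier G \<union> insert VarMark (range Bit)"
proof -
  have "set (encode_letter l) \<subseteq> Elem ` carrier G \<union> insert VarMark (range Bit)" if "l \<in> set w" for l
    using assms that by (cases l) (auto simp: pol_words_def)
  then show ?thesis by (auto simp: encode_word_def)
qed

lemma word_val_shift:
  "word_val G \<sigma> (map shift_letter w) = word_val G (\<lambda>n. \<sigma> (2 * n + 1)) w"
proof (induction w)
  case (Cons l w)
  then show ?case by (cases l) auto
qed simp

section \<open>Word values, and inverses as powers in a finite group\<close>

context group
begin

lemma word_val_closed:
  assumes "w \<in> pol_words G" "\<And>x. \<sigma> x \<in> carrier G"
  shows "word_val G \<sigma> w \<in> carrier G"
  using assms(1)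
proof (induction w)
  case (Cons l w)
  then have "letter_val \<sigma> l \<in> carrier G" "w \<in> pol_words G"
    using assms(2) by (cases l; simp add: pol_words_def)+
  with Cons.IH show ?case by simp
qed simp

lemma word_val_append:
  assumes "u \<in> pol_words G" "v \<in> pol_words G" "\<And>x. \<sigma> x \<in> carrier G"
  shows "word_val G \<sigma> (u @ v) = word_val G \<sigma> u \<otimes> word_val G \<sigma> v"
  using assms(1)
proof (induction u)
  case Nil
  then show ?case using word_val_closed[OF assms(2,3)] by simp
next
  case (Cons l u)
  then have "letter_val \<sigma> l \<in> carrier G" "u \<in> pol_words G"
    using assms(3) by (cases l; simp add: pol_words_def)+
  with Cons.IH show ?case
    using word_val_closed[OF _ assms(3)] assms(2) by (simp add: m_assoc)
qed

lemma concat_replicate_pol_words: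
  "w \<in> pol_words G \<Longrightarrow> concat (replicate n w) \<in> pol_words G"
  by (auto simp: pol_words_def)

lemma word_val_power:
  assumes "w \<in> pol_words G" "\<And>x. \<sigma> x \<in> carrier G"
  shows "word_val G \<sigma> (concat (replicate n w)) = word_val G \<sigma> w [^] n"
proof (induction n)
  case (Suc n)
  then show ?case
    using word_val_append[OF assms(1) concat_replicate_pol_words[OF assms(1)] assms(2)]
      nat_pow_Suc2[OF word_val_closed[OF assms]] by (simp del: nat_pow_Suc)
qed simp

text \<open>By Lagrange, \<open>g [^] order G = \<one>\<close>. Words have no inverse letters, so
  this power stands in for the inverse, with an exponent that depends on the group alone.\<close>

lemma pow_order_minus_one:
  assumes "finite (carrier G)" "g \<in> carrier G"
  shows "g [^] (order G - 1) = inv g"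
proof -
  have "Suc (order G - 1) = order G"
    using assms(1) order_gt_0_iff_finite by simp
  then have "g [^] (order G - 1) \<otimes> g = \<one>"
    using pow_order_eq_1[OF assms(2)] nat_pow_Suc[of g "order G - 1"] by simp
  then show ?thesis using assms(2) by (metis inv_equality nat_pow_closed)
qed

text \<open>The word \<open>z w y w\<^sup>-\<^sup>1 y\<^sup>-\<^sup>1 z\<^sup>-\<^sup>1 v\<^sup>-\<^sup>1\<close>, in which inverses are written as powers;
  shifting \<open>w\<close> to the odd variables makes \<open>z\<close> and \<open>y\<close> fresh.\<close>

definition commutator_word :: "'a \<Rightarrow> 'a letter list \<Rightarrow> 'a letter list" where
  "commutator_word v w =
    (let n = order G - 1; w' = map shift_letter w in
      [Var 0] @ w' @ [Var 2] @ concat (replicate n w') @ replicate n (Var 2) @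
      replicate n (Var 0) @ [Const (inv v)])"

lemma shift_pol_words: "w \<in> pol_words G \<Longrightarrow> map shift_letter w \<in> pol_words G"
proof -
  have "shift_letter l = Const g \<longleftrightarrow> l = Const g" for l :: "'a letter" and g
    by (cases l) auto
  then show "w \<in> pol_words G \<Longrightarrow> map shift_letter w \<in> pol_words G"
    by (auto simp: pol_words_def image_iff eq_commute[of "Const _"])
qed

lemma commutator_word_pol_words:
  "w \<in> pol_words G \<Longrightarrow> v \<in> carrier G \<Longrightarrow> commutator_word v w \<in> pol_words G"
  using shift_pol_words[of w] by (auto simp: commutator_word_def pol_words_def Let_def)

lemma word_val_commutator_word:
  assumes "finite (carrier G)" "w \<in> pol_words G" "v \<in> carrier G" and \<sigma>: "\<And>x. \<sigma> x \<in> carrier G"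
  defines "g \<equiv> word_val G (\<lambda>n. \<sigma> (2 * n + 1)) w"
  shows "word_val G \<sigma> (commutator_word v w) =
    \<sigma> 0 \<otimes> (g \<otimes> (\<sigma> 2 \<otimes> (inv g \<otimes> (inv \<sigma> 2 \<otimes> (inv \<sigma> 0 \<otimes> inv v)))))"
proof -
  have Var: "[Var x] \<in> pol_words G" for x by (simp add: pol_words_def)
  have Const: "[Const (inv v)] \<in> pol_words G" using assms(3) by (simp add: pol_words_def)
  have g: "word_val G \<sigma> (map shift_letter w) = g" "g \<in> carrier G"
    using word_val_shift[of G \<sigma> w] word_val_closed[OF assms(2)] \<sigma> by (auto simp: g_def)
  have replicate: "word_val G \<sigma> (replicate k (Var x)) = \<sigma> x [^] k \<and>
      replicate k (Var x) \<in> pol_words G" for k x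
  proof -
    have "word_val G \<sigma> (replicate k (Var x)) = \<sigma> x [^] k"
      using \<sigma> by (induction k) (simp_all add: nat_pow_Suc2[symmetric] del: nat_pow_Suc)
    then show ?thesis by (auto simp: pol_words_def)
  qed
  have append: "word_val G \<sigma> (a @ b) = word_val G \<sigma> a \<otimes> word_val G \<sigma> b \<and> a @ b \<in> pol_words G"
    if "a \<in> pol_words G" "b \<in> pol_words G" for a b
    using word_val_append[OF that \<sigma>] that by (auto simp: pol_words_def)
  show ?thesis
    \<comment> \<open>The fact \<open>append\<close> turns each \<open>@\<close> into a product; the
      equations of list append are switched off so that singleton factors are not merged into the
      remaining word.\<close>
    using g assms(1,3) \<sigma>
    by (simp add: commutator_word_def Let_def append replicate Var Const concat_replicate_pol_words
        shift_pol_words assms(2) word_val_power[OF _ \<sigma>] pow_order_minus_one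
        del: One_nat_def append_Cons append.simps)
qed

section \<open>Computing the commutator word, and correctness of the reduction\<close>

lemma polytime_computable_commutator_word:
  assumes "finite (carrier G)" "v \<in> carrier G"
  shows "polytime_computable encode_word (pol_words G) (commutator_word v)"
proof -
  define n where "n = order G - 1"
  \<comment> \<open>The program follows \<open>commutator_word\<close> factor by factor: every
    occurrence of the shifted input becomes a \<open>Copy\<close>, all else is emitted. Its length
    is fixed since \<open>n\<close> depends only on the group.\<close>
  define prog where "prog = map Emit (encode_word [Var 0]) @ [Copy] @
    map Emit (encode_word [Var 2]) @ replicate n Copy @
    map Emit (encode_word
      (replicate n (Var 2) @ replicate n (Var 0) @ [Const (inv v)]))"
  let ?A = "Elem ` carrier G \<union> insert VarMark (range Bit)"
  show ?thesis
  proof (rule polytime_computable_program[where A = ?A and prog = prog])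
    show "finite ?A" using assms(1) by simp
    have "[Var 0] \<in> pol_words G" "[Var 2] \<in> pol_words G"
      "replicate n (Var 2) @ replicate n (Var 0) @ [Const (inv v)] \<in> pol_words G"
      using assms(2) by (auto simp: pol_words_def)
    note words = this[THEN set_encode_word]
    show "s \<in> ?A" if "Emit s \<in> set prog" for s
    proof -
      have "s \<in> set (encode_word [Var 0]) \<union> set (encode_word [Var 2]) \<union> set (encode_word
        (replicate n (Var 2) @ replicate n (Var 0) @ [Const (inv v)]))"
        using that unfolding prog_def by (auto split: if_splits)
      then show ?thesis by (elim UnE) (erule words[THEN subsetD])+
    qed
    show "set (encode_word w) \<subseteq> ?A" if "w \<in> pol_words G" for w
      using that by (rule set_encode_word)
    show "encode_word (commutator_word v w) = program_output prog (encode_word w)" for w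
    proof -
      have emit: "concat (map (instr_output u \<circ> Emit) s) = s" for u and s :: "'a symbol list"
        by (induction s) auto
      have copy: "encode_word (concat (replicate k w')) = concat (replicate k (encode_word w'))"
        for k and w' :: "'a letter list"
        by (induction k) (simp_all add: encode_word_def)
      show ?thesis
        by (simp add: commutator_word_def Let_def n_def program_output_def prog_def
            emit copy encode_word_shift del: append_Cons append.simps)
    qed
  qed simp
qed

text \<open>The hypothesis \<open>comm\<close> is \<open>z [g, y] z^-1 = v\<close> with the inverses
  cleared, where \<open>[g, y] = g y g^-1 y^-1\<close>. It yields a solution whenever
  \<open>w\<close> takes a value \<open>g\<close> other than \<open>\<one>\<close>; the converse
  needs only that \<open>v\<close> is nontrivial.\<close>

lemma polytime_reducible_commutator:
  assumes "finite (carrier G)" and v: "v \<in> carrier G" "v \<noteq> \<one>"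
    and comm: "\<And>g. g \<in> carrier G \<Longrightarrow> g \<noteq> \<one> \<Longrightarrow>
      \<exists>y\<in>carrier G. \<exists>z\<in>carrier G. z \<otimes> (g \<otimes> y) = v \<otimes> (z \<otimes> (y \<otimes> g))"
  shows "polytime_reducible encode_word (pol_words G) (coPolEqv G) (PolSat G)"
proof -
  have "coPolEqv G w \<longleftrightarrow> PolSat G (commutator_word v w)" if w: "w \<in> pol_words G" for w
  proof
    assume "coPolEqv G w"
    then obtain \<sigma> where \<sigma>: "\<And>x. \<sigma> x \<in> carrier G" "word_val G \<sigma> w \<noteq> \<one>"
      by (auto simp: coPolEqv_def)
    define g where "g = word_val G \<sigma> w"
    have g: "g \<in> carrier G" "g \<noteq> \<one>" using word_val_closed[OF w] \<sigma> by (auto simp: g_def)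
    obtain y z where yz: "y \<in> carrier G" "z \<in> carrier G"
      "z \<otimes> (g \<otimes> y) = v \<otimes> (z \<otimes> (y \<otimes> g))"
      using comm[OF g] by blast
    \<comment> \<open>On odd \<open>x = 2 * n + 1\<close> this is \<open>\<sigma> n\<close>, so the
      shifted word keeps its value; at even indices other than \<open>0\<close> and \<open>2\<close>
      any group element would do.\<close>
    define \<tau> where "\<tau> x = (if x = 0 then z else if x = 2 then y else \<sigma> (x div 2))" for x
    have \<tau>: "\<And>x. \<tau> x \<in> carrier G" using \<sigma> yz by (simp add: \<tau>_def)
    have odd: "(\<lambda>n. \<tau> (2 * n + 1)) = \<sigma>" by (auto simp: \<tau>_def fun_eq_iff)
    have "word_val G \<tau> (commutator_word v w) =
        z \<otimes> (g \<otimes> (y \<otimes> (inv g \<otimes> (inv y \<otimes> (inv z \<otimes> inv v)))))"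
      unfolding word_val_commutator_word[OF assms(1) w v(1) \<tau>] odd g_def by (simp add: \<tau>_def)
    also have "\<dots> = z \<otimes> (g \<otimes> y) \<otimes> (inv g \<otimes> (inv y \<otimes> (inv z \<otimes> inv v)))"
      using yz(1,2) g v by (simp add: m_assoc)
    also have "\<dots> = v \<otimes> (z \<otimes> (y \<otimes> g)) \<otimes> inv (v \<otimes> (z \<otimes> (y \<otimes> g)))"
      unfolding yz(3) using yz(1,2) g v by (simp add: m_assoc inv_mult_group)
    also have "\<dots> = \<one>" using yz(1,2) g v by (intro r_inv) simp
    finally show "PolSat G (commutator_word v w)" using \<tau> by (auto simp: PolSat_def)
  next
    assume "PolSat G (commutator_word v w)"
    then obtain \<tau> where \<tau>: "\<And>x. \<tau> x \<in> carrier G"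
      and sat: "word_val G \<tau> (commutator_word v w) = \<one>" by (auto simp: PolSat_def)
    have cancel: "x \<otimes> (inv x \<otimes> y) = y" if "x \<in> carrier G" "y \<in> carrier G" for x y
      using that by (simp add: m_assoc[symmetric])
    \<comment> \<open>If \<open>w\<close> evaluated to \<open>\<one>\<close>, the commutator would
      collapse and the whole word would have the value \<open>inv v\<close>.\<close>
    have "word_val G (\<lambda>n. \<tau> (2 * n + 1)) w \<noteq> \<one>"
    proof
      assume "word_val G (\<lambda>n. \<tau> (2 * n + 1)) w = \<one>"
      then have "word_val G \<tau> (commutator_word v w) = inv v"
        using word_val_commutator_word[OF assms(1) w v(1) \<tau>] \<tau> v(1)
        by (simp add: cancel)
      with sat v show False by simp
    qed
    then show "coPolEqv G w"
      unfolding coPolEqv_def by (intro exI[of _ "\<lambda>n. \<tau> (2 * n + 1)"]) (simp add: \<tau>)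
  qed
  then show ?thesis
    unfolding polytime_reducible_def
    using commutator_word_pol_words[OF _ v(1)] polytime_computable_commutator_word[OF assms(1) v(1)]
    by (intro exI[of _ "commutator_word v"]) auto
qed

end

section \<open>The holomorph of a finite vector space\<close>

lemma finite_carrier_vec: "finite (carrier_vec n :: 'a::finite vec set)"
proof -
  have "x \<in> vec_of_list ` {xs. set xs \<subseteq> UNIV \<and> length xs = n}" if "x \<in> carrier_vec n" for x :: "'a vec"
    using that by (intro image_eqI[of _ _ "list_of_vec x"]) (auto simp: vec_list)
  then show ?thesis
    using finite_subset[OF subsetI finite_imageI[OF finite_lists_length_eq[OF finite]]] by blast
qed

lemma finite_carrier_mat: "finite (carrier_mat n k :: 'a::finite mat set)"
proof -
  have "A \<in> mat_of_cols n ` {xs. set xs \<subseteq> carrier_vec n \<and> length xs = k}"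
    if "A \<in> carrier_mat n k" for A :: "'a mat"
    using that cols_dim[of A] by (intro image_eqI[of _ _ "cols A"]) auto
  then show ?thesis
    using finite_subset[OF subsetI finite_imageI[OF finite_lists_length_eq[OF finite_carrier_vec]]]
    by blast
qed

section \<open>The general linear group and the group axioms of the holomorph\<close>

lemma GL_iff:
  "A \<in> GL m \<longleftrightarrow> A \<in> carrier_mat m m \<and> (\<exists>B\<in>carrier_mat m m. A * B = 1\<^sub>m m \<and> B * A = 1\<^sub>m m)"
proof
  assume A: "A \<in> GL m"
  then obtain B where B: "A * B = 1\<^sub>m m" "B * A = 1\<^sub>m (dim_row B)" "A \<in> carrier_mat m m"
    by (auto simp: GL_def invertible_mat_def inverts_mat_def)
  \<comment> \<open>The dimensions of \<open>B\<close> are read off by comparing column counts in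
    the two product equations.\<close>
  have "B \<in> carrier_mat m m"
    using arg_cong[OF B(1), of dim_col] arg_cong[OF B(2), of dim_col] B(3)
    by (intro carrier_matI) auto
  with B show "A \<in> carrier_mat m m \<and> (\<exists>B\<in>carrier_mat m m. A * B = 1\<^sub>m m \<and> B * A = 1\<^sub>m m)"
    by auto
next
  assume "A \<in> carrier_mat m m \<and> (\<exists>B\<in>carrier_mat m m. A * B = 1\<^sub>m m \<and> B * A = 1\<^sub>m m)"
  then show "A \<in> GL m"
    by (auto simp: GL_def invertible_mat_def inverts_mat_def square_mat.simps)
qed

lemma GL_inverse:
  assumes "A \<in> GL m"
  obtains B where "B \<in> GL m" "A * B = 1\<^sub>m m" "B * A = 1\<^sub>m m"
  using assms by (auto simp: GL_iff)

lemma GL_mult: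
  assumes "A \<in> GL m" "B \<in> GL m"
  shows "A * B \<in> GL m"
proof -
  obtain A' B' where inv: "A' \<in> GL m" "A * A' = 1\<^sub>m m" "A' * A = 1\<^sub>m m"
    "B' \<in> GL m" "B * B' = 1\<^sub>m m" "B' * B = 1\<^sub>m m"
    using GL_inverse[OF assms(1)] GL_inverse[OF assms(2)] by metis
  have c: "A \<in> carrier_mat m m" "B \<in> carrier_mat m m" "A' \<in> carrier_mat m m" "B' \<in> carrier_mat m m"
    using inv assms by (auto simp: GL_iff)
  have "A * B * (B' * A') = A * (B * B') * A'" "B' * A' * (A * B) = B' * (A' * A) * B"
    using c by (simp_all add: assoc_mult_mat[of _ m m _ m _ m])
  then show ?thesis
    using c inv unfolding GL_iff by (intro conjI bexI[of _ "B' * A'"]) auto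
qed

lemma one_GL: "1\<^sub>m m \<in> GL m"
  by (auto simp: GL_iff)

lemma group_Hol: "group (Hol m :: ('f::field vec \<times> 'f mat) monoid)"
proof (rule groupI)
  fix x y z :: "'f vec \<times> 'f mat"
  assume "x \<in> carrier (Hol m)" "y \<in> carrier (Hol m)" "z \<in> carrier (Hol m)"
  then obtain a A b B c C where xyz: "x = (a, A)" "y = (b, B)" "z = (c, C)"
    and vecs: "a \<in> carrier_vec m" "b \<in> carrier_vec m" "c \<in> carrier_vec m"
    and mats: "A \<in> GL m" "B \<in> GL m" "C \<in> GL m"
    by (auto simp: Hol_def)
  have cmats: "A \<in> carrier_mat m m" "B \<in> carrier_mat m m" "C \<in> carrier_mat m m"
    using mats by (auto simp: GL_iff)
  show "x \<otimes>\<^bsub>Hol m\<^esub> y \<in> carrier (Hol m)"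
    using xyz vecs cmats GL_mult[OF mats(1,2)] by (auto simp: Hol_def)
  show "x \<otimes>\<^bsub>Hol m\<^esub> y \<otimes>\<^bsub>Hol m\<^esub> z = x \<otimes>\<^bsub>Hol m\<^esub> (y \<otimes>\<^bsub>Hol m\<^esub> z)"
    using xyz vecs cmats
    by (simp add: Hol_def mult_add_distrib_mat_vec[of _ m m] assoc_mult_mat_vec[of _ m m _ m]
        assoc_add_vec[of _ m] assoc_mult_mat[of _ m m _ m _ m])
next
  fix x :: "'f vec \<times> 'f mat"
  assume "x \<in> carrier (Hol m)"
  then obtain a A where x: "x = (a, A)" "a \<in> carrier_vec m" "A \<in> GL m"
    by (auto simp: Hol_def)
  obtain B where B: "B \<in> GL m" "B * A = 1\<^sub>m m"
    using GL_inverse[OF x(3)] by metis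
  have "B \<in> carrier_mat m m" using B by (auto simp: GL_iff)
  \<comment> \<open>The inverse of \<open>(a, A)\<close> is \<open>(-(B a), B)\<close> with
    \<open>B\<close> the inverse of \<open>A\<close>; a left inverse is enough for
    \<open>groupI\<close>.\<close>
  then show "\<exists>y\<in>carrier (Hol m). y \<otimes>\<^bsub>Hol m\<^esub> x = \<one>\<^bsub>Hol m\<^esub>"
    using x B by (intro bexI[of _ "(- (B *\<^sub>v a), B)"]) (auto simp: Hol_def)
  show "\<one>\<^bsub>Hol m\<^esub> \<otimes>\<^bsub>Hol m\<^esub> x = x"
    using x by (auto simp: Hol_def GL_iff)
qed (auto simp: Hol_def one_GL)

section \<open>Transitivity of the general linear group on nonzero vectors\<close>

text \<open>Complete \<open>x\<close> to a basis starting with \<open>x\<close> and take its vectors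
  as columns: independence gives full rank, hence a nonzero determinant and an inverse.\<close>

lemma GL_transitive_unit:
  fixes x :: "'f::field vec"
  assumes "x \<in> carrier_vec m" "x \<noteq> 0\<^sub>v m"
  obtains C where "C \<in> GL m" "C *\<^sub>v unit_vec m 0 = x"
proof -
  interpret vec_space "TYPE('f)" m .
  define bs where "bs = basis_completion x"
  note bs = basis_completion[OF assms, folded bs_def]
  define C where "C = mat_of_cols m bs"
  have C: "C \<in> carrier_mat m m" "cols C = bs"
    using bs(2,6) by (auto simp: C_def)
  have "m > 0" using assms by (cases m) auto
  have "rank C = m" using lin_indpt_full_rank[OF C(1)] bs(4,5) C(2) by simp
  then have "det C \<noteq> 0" using det_rank_iff[OF C(1)] by simp
  from det_non_zero_imp_unit[OF C(1) this, of "()"] have "C \<in> GL m"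
    by (auto simp: Units_def ring_mat_def GL_iff)
  moreover have "C *\<^sub>v unit_vec m 0 = col C 0"
    using C(1) \<open>m > 0\<close> by (intro eq_vecI) auto
  moreover have "col C 0 = x"
    using C \<open>m > 0\<close> bs(6,7) by (metis carrier_matD(2) cols_nth hd_conv_nth length_greater_0_conv)
  ultimately show ?thesis using that by simp
qed

text \<open>Pass through the first unit vector, back from \<open>x\<close> and then on to
  \<open>y\<close>.\<close>

lemma GL_transitive:
  fixes x y :: "'f::field vec"
  assumes "x \<in> carrier_vec m" "x \<noteq> 0\<^sub>v m" "y \<in> carrier_vec m" "y \<noteq> 0\<^sub>v m"
  obtains C where "C \<in> GL m" "C *\<^sub>v x = y"
proof -
  obtain A where A: "A \<in> GL m" "A *\<^sub>v unit_vec m 0 = x" using GL_transitive_unit assms(1,2) .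
  obtain B where B: "B \<in> GL m" "B *\<^sub>v unit_vec m 0 = y" using GL_transitive_unit assms(3,4) .
  obtain A' where A': "A' \<in> GL m" "A' * A = 1\<^sub>m m" using GL_inverse[OF A(1)] by metis
  have c: "A \<in> carrier_mat m m" "B \<in> carrier_mat m m" "A' \<in> carrier_mat m m"
    using A B A' by (auto simp: GL_iff)
  have "A' *\<^sub>v x = unit_vec m 0"
    using c A(2) A'(2) assoc_mult_mat_vec[of A' m m A m "unit_vec m 0"] by simp
  then have "(B * A') *\<^sub>v x = y"
    using c B(2) assms(1) by simp
  then show ?thesis using that GL_mult[OF B(1) A'(1)] by blast
qed

section \<open>Nontrivial translations as commutators\<close>

text \<open>This is where \<open>(m, q) = (1, 2)\<close> must be excluded: there the space has a
  single nonzero vector.\<close>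

lemma ex_other_nonzero_vec:
  fixes a :: "'f::{field,finite} vec"
  assumes "m \<ge> 1" "(m, CARD('f)) \<noteq> (1, 2)" "a \<in> carrier_vec m" "a \<noteq> 0\<^sub>v m"
  obtains b where "b \<in> carrier_vec m" "b \<noteq> 0\<^sub>v m" "b \<noteq> a"
proof (cases "m = 1")
  case True
  have "UNIV \<noteq> {0, 1 :: 'f}"
    using assms(2) True by (metis card_2_iff zero_neq_one)
  then obtain c :: 'f where c: "c \<noteq> 0" "c \<noteq> 1" by auto
  obtain i where i: "i < m" "a $ i \<noteq> 0" using assms(3,4) by (metis eq_vecI carrier_vecD index_zero_vec)
  have "(c \<cdot>\<^sub>v a) $ i \<noteq> 0" "(c \<cdot>\<^sub>v a) $ i \<noteq> a $ i" using c i assms(3) by auto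
  then show ?thesis using that[of "c \<cdot>\<^sub>v a"] i assms(3) by fastforce
next
  case False
  then have m: "0 < m" "1 < m" using assms(1) by auto
  \<comment> \<open>Of two distinct nonzero vectors, at least one differs from
    \<open>a\<close>.\<close>
  then have "(unit_vec m 0 :: 'f vec) \<noteq> unit_vec m 1" by simp
  then show ?thesis
    using that[of "unit_vec m 0"] that[of "unit_vec m 1"] m by (metis unit_vec_carrier unit_vec_nonzero)
qed

text \<open>A matrix that fixes every unit vector has the columns of the identity.\<close>

lemma ex_moved_vec:
  fixes B :: "'f::field mat"
  assumes "B \<in> carrier_mat m m" "B \<noteq> 1\<^sub>m m"
  obtains (moved) u where "u \<in> carrier_vec m" "B *\<^sub>v u \<noteq> u"
proof (rule ccontr)
  assume none: "\<not> thesis"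
  have fixed: "B *\<^sub>v u = u" if "u \<in> carrier_vec m" for u using none moved that by blast
  have "B = 1\<^sub>m m"
  proof (rule eq_matI)
    fix i j assume ij: "i < dim_row (1\<^sub>m m :: 'f mat)" "j < dim_col (1\<^sub>m m :: 'f mat)"
    then have "B $$ (i, j) = (B *\<^sub>v unit_vec m j) $ i" using assms(1) by simp
    then show "B $$ (i, j) = 1\<^sub>m m $$ (i, j)" using ij fixed[of "unit_vec m j"] by simp
  qed (use assms in auto)
  with assms(2) show False by simp
qed

lemma Hol_commutator:
  fixes g :: "'f::{field,finite} vec \<times> 'f mat"
  assumes "m \<ge> 1" "(m, CARD('f)) \<noteq> (1, 2)"
    and e: "e \<in> carrier_vec m" "e \<noteq> 0\<^sub>v m"
    and g: "g \<in> carrier (Hol m)" "g \<noteq> \<one>\<^bsub>Hol m\<^esub>"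
  shows "\<exists>y\<in>carrier (Hol m). \<exists>z\<in>carrier (Hol m).
    z \<otimes>\<^bsub>Hol m\<^esub> (g \<otimes>\<^bsub>Hol m\<^esub> y) =
    (e, 1\<^sub>m m) \<otimes>\<^bsub>Hol m\<^esub> (z \<otimes>\<^bsub>Hol m\<^esub> (y \<otimes>\<^bsub>Hol m\<^esub> g))"
proof -
  interpret group "Hol m :: ('f vec \<times> 'f mat) monoid" by (rule group_Hol)
  obtain a B where aB: "g = (a, B)" "a \<in> carrier_vec m" "B \<in> GL m" "B \<in> carrier_mat m m"
    using g(1) by (auto simp: Hol_def GL_iff)
  have "\<exists>y\<in>carrier (Hol m). \<exists>d\<in>carrier_vec m. d \<noteq> 0\<^sub>v m \<and>
      g \<otimes>\<^bsub>Hol m\<^esub> y = (d, 1\<^sub>m m) \<otimes>\<^bsub>Hol m\<^esub> (y \<otimes>\<^bsub>Hol m\<^esub> g)"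
  proof (cases "B = 1\<^sub>m m")
    case True
    then have "a \<noteq> 0\<^sub>v m" using g(2) aB by (auto simp: Hol_def)
    \<comment> \<open>For \<open>g = (a, 1)\<close> and \<open>y = (0, C)\<close> the commutator is
      translation by \<open>a - C a\<close>. So \<open>C a = b\<close> must be nonzero to be
      reachable and differ from \<open>a\<close> to give a nonzero result.\<close>
    then obtain b where b: "b \<in> carrier_vec m" "b \<noteq> 0\<^sub>v m" "b \<noteq> a"
      using ex_other_nonzero_vec assms(1,2) aB(2) by metis
    obtain C where C: "C \<in> GL m" "C *\<^sub>v a = b"
      using GL_transitive[OF aB(2) \<open>a \<noteq> 0\<^sub>v m\<close> b(1,2)] .
    have Cc: "C \<in> carrier_mat m m" using C by (simp add: GL_iff)
    have "a - b + b = a" using aB b by auto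
    moreover have "a - b \<noteq> 0\<^sub>v m"
      using \<open>a - b + b = a\<close> b by auto
    ultimately show ?thesis
      using aB b C Cc True
      by (intro bexI[of _ "(0\<^sub>v m, C)"] bexI[of _ "a - b"]) (auto simp: Hol_def)
  next
    case False
    then obtain u where u: "u \<in> carrier_vec m" "B *\<^sub>v u \<noteq> u" by (rule ex_moved_vec[OF aB(4)])
    \<comment> \<open>With \<open>y\<close> the translation by \<open>u\<close>, \<open>g y\<close>
      and \<open>y g\<close> have the vectors \<open>a + B u\<close> and \<open>u + a\<close> and
      the same linear part \<open>B\<close>.\<close>
    define d where "d = B *\<^sub>v u - u"
    have d: "d \<in> carrier_vec m" "d + u = B *\<^sub>v u" using u aB by (auto simp: d_def)
    have "d \<noteq> 0\<^sub>v m" using d u by auto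
    moreover have "d + (u + a) = a + B *\<^sub>v u"
      using d u aB assoc_add_vec[of d m u a] comm_add_vec[of a m "B *\<^sub>v u"] by simp
    ultimately show ?thesis
      using aB u d one_GL
      by (intro bexI[of _ "(u, 1\<^sub>m m)"] bexI[of _ d]) (auto simp: Hol_def)
  qed
  then obtain y d where y: "y \<in> carrier (Hol m)" and d: "d \<in> carrier_vec m" "d \<noteq> 0\<^sub>v m"
    and gy: "g \<otimes>\<^bsub>Hol m\<^esub> y = (d, 1\<^sub>m m) \<otimes>\<^bsub>Hol m\<^esub> (y \<otimes>\<^bsub>Hol m\<^esub> g)" by blast
  obtain C where C: "C \<in> GL m" "C *\<^sub>v d = e" using GL_transitive[OF d e] .
  define z where "z = (0\<^sub>v m :: 'f vec, C)"
  have z: "z \<in> carrier (Hol m)" and t: "(d, 1\<^sub>m m) \<in> carrier (Hol m)" "(e, 1\<^sub>m m) \<in> carrier (Hol m)"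
    using C d e one_GL by (auto simp: Hol_def z_def)
  \<comment> \<open>Conjugating the translation by \<open>d\<close> with the linear map
    \<open>C\<close> gives the translation by \<open>C d = e\<close>.\<close>
  have zd: "z \<otimes>\<^bsub>Hol m\<^esub> (d, 1\<^sub>m m) = (e, 1\<^sub>m m) \<otimes>\<^bsub>Hol m\<^esub> z"
    using C d e by (auto simp: Hol_def z_def GL_iff)
  have "z \<otimes>\<^bsub>Hol m\<^esub> (g \<otimes>\<^bsub>Hol m\<^esub> y) =
      (z \<otimes>\<^bsub>Hol m\<^esub> (d, 1\<^sub>m m)) \<otimes>\<^bsub>Hol m\<^esub> (y \<otimes>\<^bsub>Hol m\<^esub> g)"
    unfolding gy using z t y g by (simp add: m_assoc)
  also have "\<dots> = (e, 1\<^sub>m m) \<otimes>\<^bsub>Hol m\<^esub> (z \<otimes>\<^bsub>Hol m\<^esub> (y \<otimes>\<^bsub>Hol m\<^esub> g))"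
    unfolding zd using z t y g by (simp add: m_assoc)
  finally show ?thesis using y z by blast
qed

theorem theorem5p1:
  fixes m q :: nat and G :: "('f::{field,finite} vec \<times> 'f mat) monoid"
  assumes "m \<ge> 1" and "primepow q" and "CARD('f) = q" and "(m, q) \<noteq> (1, 2)"
    and "G = Hol m"
  shows "polytime_reducible encode_word (pol_words G) (coPolEqv G) (PolSat G)"
proof -
  \<comment> \<open>Any nonzero vector could serve as the fixed translation;
    \<open>m \<ge> 1\<close> guarantees this one.\<close>
  let ?e = "unit_vec m 0 :: 'f vec"
  have e: "?e \<in> carrier_vec m" "?e \<noteq> 0\<^sub>v m" using assms(1) by auto
  have "finite (carrier G)"
    unfolding assms(5) Hol_def GL_def
    by (auto intro: finite_subset[OF _ finite_carrier_mat] simp: finite_carrier_vec)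
  moreover have "(?e, 1\<^sub>m m) \<in> carrier G" "(?e, 1\<^sub>m m) \<noteq> \<one>\<^bsub>G\<^esub>"
    using e one_GL by (auto simp: assms(5) Hol_def)
  moreover have "\<exists>y\<in>carrier G. \<exists>z\<in>carrier G.
      z \<otimes>\<^bsub>G\<^esub> (g \<otimes>\<^bsub>G\<^esub> y) = (?e, 1\<^sub>m m) \<otimes>\<^bsub>G\<^esub> (z \<otimes>\<^bsub>G\<^esub> (y \<otimes>\<^bsub>G\<^esub> g))"
    if "g \<in> carrier G" "g \<noteq> \<one>\<^bsub>G\<^esub>" for g
    using Hol_commutator[OF assms(1) _ e, of g] that assms(3-5) by simp
  ultimately show ?thesis
    using group.polytime_reducible_commutator[OF group_Hol[of m, where 'f = 'f, folded assms(5)]]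
    by blast
qed

end
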